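(* Let $d\ge 1$, let $\mathbf f=(f_1,\dots,f_d)$ be a system of formal Taylor expansions about the origin with complex coefficients and let $\mathbf m=(m_1,\dots,m_d)\in\mathbb Z_+^d\setminus\{\mathbf 0\}$. Let $(q_{n,\mathbf m})$ be the sequence of common denominators of a chosen sequence of type II Hermite-Padé approximants of $\mathbf f$ with respect to $\mathbf m$. If $\zeta\in\mathbb C\setminus\{0\}$ is a system pole of order $\tau$ of $\mathbf f$ with respect to $\mathbf m$, then $\mu(\zeta)\ge\tau$.
   Context: Hermite-Padé approximants. Let $|\mathbf m|=m_1+\cdots+m_d$. For each $n\ge\max\{m_1,\dots,m_d\}$ there exist polynomials $q,p_1,\dots,p_d$ with $\deg p_k\le n-m_k$ ($k=1,\dots,d$), $\deg q\le|\mathbf m|$, $q\not\equiv0$, and $q(z)f_k(z)-p_k(z)=A_kz^{n+1}+\cdots$ (a power series containing only powers $z^j$ with $j\ge n+1$) for $k=1,\dots,d$. The vector rational function $(p_1/q,\dots,p_d/q)$ is called an $(n,\mathbf m)$ (type II) Hermite-Padé approximant of $\mathbf f$. It is in general not unique; for each $n$ one particular solution is chosen, and after cancelling common factors it is written $(p_{n,\mathbf m,1},\dots,p_{n,\mathbf m,d})/q_{n,\mathbf m}$ with $q_{n,\mathbf m}$ monic and having no zero common to all the $p_{n,\mathbf m,k}$. System poles. A point $\zeta\in\mathbb C\setminus\{0\}$ is a system pole of order $\tau$ of $\mathbf f$ with respect to $\mathbf m$ if $\tau$ is the largest positive integer such that for each $s=1,\dots,\tau$ there exists at least one polynomial combination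 $\sum_{k=1}^d p_kf_k$ with $p_k$ polynomials, $\deg p_k<m_k$ (and $p_k\equiv0$ if $m_k=0$), which is analytic on a neighborhood of the closed disk $\{z:|z|\le|\zeta|\}$ except for a pole at $z=\zeta$ of exact order $s$. The quantity $\mu(\zeta)$. Let $\zeta_{n,1},\dots,\zeta_{n,\ell_n}$, $0\le\ell_n\le|\mathbf m|$, be the zeros of $q_{n,\mathbf m}$ (with multiplicity) indexed so that $|\zeta-\zeta_{n,1}|\le\cdots\le|\zeta-\zeta_{n,\ell_n}|$; by convention $|\zeta-\zeta_{n,\nu}|:=1$ for $\nu>\ell_n$. Then $\mu(\zeta):=\nu$ if $\limsup_{n\to\infty}|\zeta-\zeta_{n,\nu}|^{1/n}<1$ and $\limsup_{n\to\infty}|\zeta-\zeta_{n,\nu+1}|^{1/n}\ge1$; and $\mu(\zeta)=0$ if $\limsup_{n\to\infty}|\zeta-\zeta_{n,1}|^{1/n}\ge1$. *)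

theory Defs
  imports "HOL-Complex_Analysis.Complex_Analysis"
begin

text \<open>
  Systems \<open>f\<close> of formal power series and multi-indices \<open>m\<close> are indexed by \<open>{1..d}\<close>;
  the values of these functions at other indices play no role.
\<close>

text \<open>
  A solution \<open>(p, q)\<close> of the \<open>(n, m)\<close> Hermite-Pade problem, before cancellation of common
  factors.  Only used for \<open>n \<ge> Max (m ` {1..d})\<close>, so that the subtraction \<open>n - m k\<close> is not truncated.
\<close>
definition hermite_pade_solution ::
  "nat \<Rightarrow> (nat \<Rightarrow> complex fps) \<Rightarrow> (nat \<Rightarrow> nat) \<Rightarrow> nat \<Rightarrow> (nat \<Rightarrow> complex poly) \<Rightarrow> complex poly \<Rightarrow> bool"
where
  "hermite_pade_solution d f m n p q \<longleftrightarrow>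
     q \<noteq> 0 \<and> degree q \<le> (\<Sum>k=1..d. m k) \<and>
     (\<forall>k\<in>{1..d}. degree (p k) \<le> n - m k \<and>
        (\<forall>j\<le>n. fps_nth (fps_of_poly q * f k - fps_of_poly (p k)) j = 0))"

text \<open>\<open>(P, Q)\<close> arises from \<open>(p, q)\<close> by cancelling common factors, with \<open>Q\<close> normalised to be monic.\<close>
definition reduced_form ::
  "nat \<Rightarrow> (nat \<Rightarrow> complex poly) \<Rightarrow> complex poly \<Rightarrow> (nat \<Rightarrow> complex poly) \<Rightarrow> complex poly \<Rightarrow> bool"
where
  "reduced_form d p q P Q \<longleftrightarrow>
     (\<exists>h. h \<noteq> 0 \<and> q = h * Q \<and> (\<forall>k\<in>{1..d}. p k = h * P k)) \<and>
     lead_coeff Q = 1 \<and>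
     \<not> (\<exists>z. poly Q z = 0 \<and> (\<forall>k\<in>{1..d}. poly (P k) z = 0))"

definition hermite_pade_denominator ::
  "nat \<Rightarrow> (nat \<Rightarrow> complex fps) \<Rightarrow> (nat \<Rightarrow> nat) \<Rightarrow> nat \<Rightarrow> complex poly \<Rightarrow> bool"
where
  "hermite_pade_denominator d f m n Q \<longleftrightarrow>
     (\<exists>p q P. hermite_pade_solution d f m n p q \<and> reduced_form d p q P Q)"

text \<open>
  The formal power series \<open>g\<close> converges near the origin, and its sum extends to a function
  analytic on a neighbourhood of the closed disk of radius \<open>\<bar>\<zeta>\<bar>\<close> except for a pole at \<open>\<zeta>\<close>
  of exact order \<open>s\<close> (\<open>zorder\<close> is negative at poles).  The series \<open>f k\<close> entering a combination
  need not converge individually.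
\<close>
definition analytic_except_pole :: "complex fps \<Rightarrow> complex \<Rightarrow> nat \<Rightarrow> bool" where
  "analytic_except_pole g \<zeta> s \<longleftrightarrow>
     (\<exists>F U. open U \<and> cball 0 (cmod \<zeta>) \<subseteq> U \<and> F holomorphic_on (U - {\<zeta>}) \<and>
        F has_fps_expansion g \<and> is_pole F \<zeta> \<and> zorder F \<zeta> = - int s)"

definition has_pole_combination ::
  "nat \<Rightarrow> (nat \<Rightarrow> complex fps) \<Rightarrow> (nat \<Rightarrow> nat) \<Rightarrow> complex \<Rightarrow> nat \<Rightarrow> bool"
where
  "has_pole_combination d f m \<zeta> s \<longleftrightarrow>
     (\<exists>p :: nat \<Rightarrow> complex poly.
        (\<forall>k\<in>{1..d}. if m k = 0 then p k = 0 else degree (p k) < m k) \<and>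
        analytic_except_pole (\<Sum>k=1..d. fps_of_poly (p k) * f k) \<zeta> s)"

definition is_system_pole ::
  "nat \<Rightarrow> (nat \<Rightarrow> complex fps) \<Rightarrow> (nat \<Rightarrow> nat) \<Rightarrow> complex \<Rightarrow> nat \<Rightarrow> bool"
where
  "is_system_pole d f m \<zeta> \<tau> \<longleftrightarrow>
     \<zeta> \<noteq> 0 \<and> \<tau> \<ge> 1 \<and> (\<forall>s\<in>{1..\<tau>}. has_pole_combination d f m \<zeta> s) \<and>
     (\<forall>t\<ge>1. (\<forall>s\<in>{1..t}. has_pole_combination d f m \<zeta> s) \<longrightarrow> t \<le> \<tau>)"

text \<open>
  \<open>zero_dist \<zeta> Q \<nu>\<close>, for \<open>\<nu> \<ge> 1\<close>, is the distance of \<open>\<zeta>\<close> to the \<open>\<nu>\<close>-th closest zero of \<open>Q\<close>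
  (with multiplicity), and \<open>1\<close> if \<open>Q\<close> has fewer than \<open>\<nu>\<close> zeros.  The sorted list of distances
  does not depend on how zeros at equal distance are ordered.
\<close>
definition zero_dist :: "complex \<Rightarrow> complex poly \<Rightarrow> nat \<Rightarrow> real" where
  "zero_dist \<zeta> Q \<nu> =
     (let ds = sorted_list_of_multiset (image_mset (\<lambda>z. cmod (\<zeta> - z)) (proots Q))
      in if \<nu> \<le> length ds then ds ! (\<nu> - 1) else 1)"

definition zero_rate :: "(nat \<Rightarrow> complex poly) \<Rightarrow> complex \<Rightarrow> nat \<Rightarrow> ereal" where
  "zero_rate Q \<zeta> \<nu> = limsup (\<lambda>n. ereal (root n (zero_dist \<zeta> (Q n) \<nu>)))"

text \<open>The description is unique and satisfiable as soon as the degrees of the \<open>Q n\<close>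
  are eventually bounded; see \<open>pole_mu_ex1\<close>.\<close>
definition pole_mu :: "(nat \<Rightarrow> complex poly) \<Rightarrow> complex \<Rightarrow> nat" where
  "pole_mu Q \<zeta> = (THE \<nu>. (\<nu> \<ge> 1 \<longrightarrow> zero_rate Q \<zeta> \<nu> < 1) \<and> zero_rate Q \<zeta> (\<nu> + 1) \<ge> 1)"

lemma zero_rate_less_1_mono:
  assumes "zero_rate Q \<zeta> \<nu> < 1" "1 \<le> \<mu>" "\<mu> \<le> \<nu>"
  shows "zero_rate Q \<zeta> \<mu> < 1"
proof -
  have "eventually (\<lambda>n. ereal (root n (zero_dist \<zeta> (Q n) \<nu>)) < 1) sequentially"
    using assms(1) unfolding zero_rate_def by (rule Limsup_lessD)
  then have "eventually (\<lambda>n. root n (zero_dist \<zeta> (Q n) \<mu>) \<le> root n (zero_dist \<zeta> (Q n) \<nu>)) sequentially"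
    using eventually_gt_at_top[of 0]
  proof eventually_elim
    case (elim n)
    let ?ds = "sorted_list_of_multiset (image_mset (\<lambda>z. cmod (\<zeta> - z)) (proots (Q n)))"
    have "\<nu> \<le> length ?ds"
      using elim by (auto simp: zero_dist_def Let_def split: if_splits)
    then have "zero_dist \<zeta> (Q n) \<mu> \<le> zero_dist \<zeta> (Q n) \<nu>"
      using assms(2,3) sorted_sorted_list_of_multiset
      by (simp add: zero_dist_def Let_def sorted_nth_mono)
    then show ?case using elim by simp
  qed
  then have "zero_rate Q \<zeta> \<mu> \<le> zero_rate Q \<zeta> \<nu>"
    unfolding zero_rate_def by (intro Limsup_mono) simp
  then show ?thesis using assms(1) by simp
qed

lemma zero_rate_beyond_degree:
  assumes "eventually (\<lambda>n. degree (Q n) \<le> N) sequentially"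
  shows "zero_rate Q \<zeta> (N + 1) = 1"
proof -
  have "eventually (\<lambda>n. ereal (root n (zero_dist \<zeta> (Q n) (N + 1))) = 1) sequentially"
    using assms eventually_gt_at_top[of 0]
  proof eventually_elim
    case (elim n)
    have "length (sorted_list_of_multiset (image_mset (\<lambda>z. cmod (\<zeta> - z)) (proots (Q n)))) \<le> N"
      using elim size_proots_le[of "Q n"] by (metis le_trans mset_sorted_list_of_multiset size_image_mset size_mset)
    then show ?case using elim by (auto simp: zero_dist_def Let_def)
  qed
  from Limsup_eq[OF this] show ?thesis
    by (simp add: zero_rate_def Limsup_const)
qed

lemma pole_mu_ex1:
  assumes "eventually (\<lambda>n. degree (Q n) \<le> N) sequentially"
  shows "\<exists>!\<nu>. (\<nu> \<ge> 1 \<longrightarrow> zero_rate Q \<zeta> \<nu> < 1) \<and> zero_rate Q \<zeta> (\<nu> + 1) \<ge> 1"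
proof -
  let ?P = "\<lambda>\<nu>. zero_rate Q \<zeta> (\<nu> + 1) \<ge> 1"
  have "?P N" using zero_rate_beyond_degree[OF assms, of \<zeta>] by simp
  then obtain l where L: "?P l" and l: "\<And>\<nu>. \<nu> < l \<Longrightarrow> \<not> ?P \<nu>"
    using exists_least_iff[of ?P] by blast
  show ?thesis
  proof (rule ex1I[of _ l], intro conjI impI L)
    assume "l \<ge> 1"
    then show "zero_rate Q \<zeta> l < 1"
      using l[of "l - 1"] by (simp add: not_le)
  next
    fix \<nu> assume \<nu>: "(\<nu> \<ge> 1 \<longrightarrow> zero_rate Q \<zeta> \<nu> < 1) \<and> ?P \<nu>"
    show "\<nu> = l"
    proof (rule linorder_cases[of \<nu> l])
      assume "\<nu> < l"
      with l \<nu> show ?thesis by blast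
    next
      assume "l < \<nu>"
      then have "zero_rate Q \<zeta> (l + 1) < 1"
        using \<nu> by (intro zero_rate_less_1_mono[of Q \<zeta> \<nu> "l + 1"]) linarith+
      then have False using L by (meson leD)
      then show ?thesis ..
    qed
  qed
qed

end

theory Submission
  imports Defs "HOL-Computational_Algebra.Fundamental_Theorem_Algebra"
begin

text \<open>
  If a combination \<open>g = \<Sum>k. p\<^sub>k f\<^sub>k\<close> is admissible, then a single coefficient of \<open>Q\<^sub>n g\<close>, with index
  \<open>N\<close> at bounded distance from \<open>n\<close>, vanishes: it lies above the degree of \<open>\<Sum>k. p\<^sub>k P\<^sub>k\<close> and below the
  order of \<open>Q\<^sub>n g - \<Sum>k. p\<^sub>k P\<^sub>k\<close>.  Expand \<open>Q\<^sub>n = \<Sum>j. c\<^sub>j (z - \<zeta>)^j\<close>, and let \<open>g\<close> have a pole of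
  order \<open>s + 1\<close> at \<open>\<zeta>\<close>.  The \<open>N\<close>-th coefficient of \<open>(z - \<zeta>)^j g\<close>, scaled by \<open>\<bar>\<zeta>\<bar>^N\<close>, is geometrically small
  for \<open>j > s\<close>, bounded away from \<open>0\<close> for \<open>j = s\<close>, and of subexponential growth for \<open>j < s\<close>.  By induction
  on \<open>s\<close>, all \<open>c\<^sub>j\<close> with \<open>j < \<tau>\<close> are geometrically small relative to \<open>\<Sum>j. \<bar>c\<^sub>j\<bar>\<close>.  This is
  impossible if fewer than \<open>\<tau>\<close> zeros of \<open>Q\<^sub>n\<close> are within geometrically small distance of \<open>\<zeta>\<close>.
\<close>

section \<open>Geometrically small sequences\<close>

text \<open>Encodes \<open>limsup\<close> of \<open>\<bar>a n\<bar>\<close> to the power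
  \<open>1/n\<close> being below 1. The big-O form hides constants and finitely many terms, so sums
  and comparisons need no roots.\<close>

definition exp_small :: "(nat \<Rightarrow> real) \<Rightarrow> bool" where
  "exp_small a \<longleftrightarrow> (\<exists>\<theta>. 0 < \<theta> \<and> \<theta> < 1 \<and> a \<in> O(\<lambda>n. \<theta> ^ n))"

lemma exp_smallI:
  assumes "0 < \<theta>" "\<theta> < 1" "eventually (\<lambda>n. \<bar>a n\<bar> \<le> C * \<theta> ^ n) sequentially"
  shows "exp_small a"
  unfolding exp_small_def
proof (intro exI conjI)
  show "a \<in> O(\<lambda>n. \<theta> ^ n)"
    using assms by (intro bigoI[of _ C]) (simp add: power_abs)
qed (use assms in auto)

lemma exp_smallE:
  assumes "exp_small a"
  obtains \<theta> C where "0 < \<theta>" "\<theta> < 1" "C > 0" "eventually (\<lambda>n. \<bar>a n\<bar> \<le> C * \<theta> ^ n) sequentially"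
proof -
  obtain \<theta> where \<theta>: "0 < \<theta>" "\<theta> < 1" "a \<in> O(\<lambda>n. \<theta> ^ n)"
    using assms by (auto simp: exp_small_def)
  from \<theta>(3) obtain C where "C > 0" "eventually (\<lambda>n. norm (a n) \<le> C * norm (\<theta> ^ n)) sequentially"
    by (elim landau_o.bigE)
  with that \<theta> show thesis by (simp add: power_abs)
qed

lemma exp_small_mono:
  assumes "exp_small b" "eventually (\<lambda>n. \<bar>a n\<bar> \<le> C * \<bar>b n\<bar>) sequentially"
  shows "exp_small a"
proof -
  have "a \<in> O(b)"
    using assms(2) by (intro bigoI[of _ C]) simp
  with assms(1) show ?thesis
    unfolding exp_small_def by (blast intro: landau_o.big_trans)
qed

lemma exp_small_0: "exp_small (\<lambda>n. 0)"
  by (rule exp_smallI[of "1/2" _ 0]) auto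

lemma exp_small_add:
  assumes "exp_small a" "exp_small b"
  shows "exp_small (\<lambda>n. a n + b n)"
proof -
  obtain \<theta>1 C1 where 1: "0 < \<theta>1" "\<theta>1 < 1" "C1 > 0"
    "eventually (\<lambda>n. \<bar>a n\<bar> \<le> C1 * \<theta>1 ^ n) sequentially"
    using exp_smallE[OF assms(1)] .
  obtain \<theta>2 C2 where 2: "0 < \<theta>2" "\<theta>2 < 1" "C2 > 0"
    "eventually (\<lambda>n. \<bar>b n\<bar> \<le> C2 * \<theta>2 ^ n) sequentially"
    using exp_smallE[OF assms(2)] .
  show ?thesis
  proof (rule exp_smallI)
    show "eventually (\<lambda>n. \<bar>a n + b n\<bar> \<le> (C1 + C2) * max \<theta>1 \<theta>2 ^ n) sequentially"
      using 1(4) 2(4)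
    proof eventually_elim
      case (elim n)
      have "C1 * \<theta>1 ^ n \<le> C1 * max \<theta>1 \<theta>2 ^ n" "C2 * \<theta>2 ^ n \<le> C2 * max \<theta>1 \<theta>2 ^ n"
        using 1 2 by (auto intro!: mult_left_mono power_mono)
      then show ?case using elim by (simp add: distrib_right)
    qed
  qed (use 1 2 in auto)
qed

lemma exp_small_sum:
  assumes "\<And>i. i \<in> I \<Longrightarrow> exp_small (a i)"
  shows "exp_small (\<lambda>n. \<Sum>i\<in>I. a i n)"
  using assms by (induction I rule: infinite_finite_induct) (auto intro: exp_small_0 exp_small_add)

section \<open>Coefficient asymptotics of power series at the radius
  \<open>norm \<zeta>\<close>\<close>

lemma fps_coeff_bound:
  fixes K :: "complex fps"
  assumes "0 < r" "ereal r < fps_conv_radius K"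
  obtains C where "C > 0" "\<And>n. norm (fps_nth K n) * r ^ n \<le> C"
proof -
  have "summable (\<lambda>n. norm (fps_nth K n * of_real r ^ n))"
    using assms by (intro norm_summable_fps) simp
  then have "Bseq (\<lambda>n. norm (fps_nth K n * of_real r ^ n))"
    by (intro convergent_imp_Bseq summable_LIMSEQ_zero[THEN convergentI])
  then obtain C where "C > 0" "\<forall>n. norm (norm (fps_nth K n * of_real r ^ n)) \<le> C"
    by (elim BseqE)
  with that assms(1) show thesis by (simp add: norm_mult norm_power)
qed

text \<open>Coefficients are dominated by \<open>1 / r ^ n\<close> for any \<open>r\<close> between
  \<open>R\<close> and the radius of convergence, which leaves a decay of ratio
  \<open>\<eta> = R / r\<close>. The lag of \<open>N n\<close> behind \<open>n\<close> costs only
  the constant \<open>1 / \<eta> ^ M\<close>.\<close>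

lemma fps_coeff_exp_small:
  fixes K :: "complex fps"
  assumes "0 < R" "ereal R < fps_conv_radius K" "eventually (\<lambda>n. n \<le> N n + M) sequentially"
  shows "exp_small (\<lambda>n. norm (fps_nth K (N n)) * R ^ N n)"
proof -
  obtain r where r: "R < r" "ereal r < fps_conv_radius K"
    using ereal_dense2[OF assms(2)] by auto
  obtain C where C: "C > 0" "\<And>n. norm (fps_nth K n) * r ^ n \<le> C"
    using fps_coeff_bound r assms(1) by (metis less_trans)
  define \<eta> where "\<eta> = R / r"
  have \<eta>: "0 < \<eta>" "\<eta> < 1" using r assms(1) by (auto simp: \<eta>_def)
  show ?thesis
  proof (rule exp_smallI[OF \<eta>])
    show "eventually (\<lambda>n. \<bar>norm (fps_nth K (N n)) * R ^ N n\<bar> \<le> (C / \<eta> ^ M) * \<eta> ^ n) sequentially"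
      using assms(3)
    proof eventually_elim
      case (elim n)
      have "norm (fps_nth K (N n)) * R ^ N n = (norm (fps_nth K (N n)) * r ^ N n) * \<eta> ^ N n"
        using r assms(1) by (simp add: \<eta>_def field_simps)
      also have "\<dots> \<le> C * \<eta> ^ N n"
        using C \<eta> by (intro mult_right_mono) auto
      also have "\<dots> = (C / \<eta> ^ M) * \<eta> ^ (N n + M)"
        using \<eta> by (simp add: power_add)
      also have "\<dots> \<le> (C / \<eta> ^ M) * \<eta> ^ n"
        using \<eta> C elim by (intro mult_left_mono power_decreasing) auto
      finally show ?case using assms(1) by simp
    qed
  qed
qed

text \<open>With \<open>R\<close> possibly equal to the radius of convergence, the scaled
  coefficients may be unbounded but grow subexponentially. The decay of \<open>a\<close> is split as
  \<open>\<theta> = t * t\<close>: one factor \<open>t ^ n\<close> absorbs this growth, the other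
  remains.\<close>

lemma exp_small_mult_fps_coeff:
  fixes K :: "complex fps"
  assumes "0 < R" "ereal R \<le> fps_conv_radius K" "eventually (\<lambda>n. N n \<le> n) sequentially" "exp_small a"
  shows "exp_small (\<lambda>n. a n * (norm (fps_nth K (N n)) * R ^ N n))"
proof -
  obtain \<theta> A where \<theta>: "0 < \<theta>" "\<theta> < 1" "A > 0" "eventually (\<lambda>n. \<bar>a n\<bar> \<le> A * \<theta> ^ n) sequentially"
    using exp_smallE[OF assms(4)] .
  define t where "t = sqrt \<theta>"
  have t: "0 < t" "t < 1" "t * t = \<theta>" using \<theta> by (auto simp: t_def)
  have "ereal (R * t) < ereal R" using t assms(1) by simp
  then obtain C where C: "C > 0" "\<And>n. norm (fps_nth K n) * (R * t) ^ n \<le> C"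
    using fps_coeff_bound[of "R * t" K] t assms(1,2) by (metis mult_pos_pos order_less_le_trans)
  show ?thesis
  proof (rule exp_smallI[OF t(1,2)])
    show "eventually (\<lambda>n. \<bar>a n * (norm (fps_nth K (N n)) * R ^ N n)\<bar> \<le> (A * C) * t ^ n) sequentially"
      using assms(3) \<theta>(4)
    proof eventually_elim
      case (elim n)
      have "(norm (fps_nth K (N n)) * R ^ N n) * t ^ n \<le> (norm (fps_nth K (N n)) * R ^ N n) * t ^ N n"
        using t elim assms(1) by (intro mult_left_mono power_decreasing) auto
      also have "\<dots> \<le> C" using C(2)[of "N n"] by (simp add: power_mult_distrib mult_ac)
      finally have 1: "(norm (fps_nth K (N n)) * R ^ N n) * t ^ n \<le> C" .
      have "\<bar>a n\<bar> * (norm (fps_nth K (N n)) * R ^ N n) \<le> (A * \<theta> ^ n) * (norm (fps_nth K (N n)) * R ^ N n)"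
        using elim assms(1) by (intro mult_right_mono) auto
      also have "\<dots> = (A * t ^ n) * ((norm (fps_nth K (N n)) * R ^ N n) * t ^ n)"
        unfolding t(3)[symmetric] by (simp add: power_mult_distrib mult_ac)
      also have "\<dots> \<le> (A * t ^ n) * C"
        using 1 \<theta> t by (intro mult_left_mono) auto
      finally show ?case using assms(1) by (simp add: abs_mult mult_ac)
    qed
  qed
qed

text \<open>The partial sums at \<open>\<zeta>\<close> of the series \<open>(z - \<zeta>) K\<close>
  telescope to a single term, a multiple of the coefficient \<open>fps_nth K n\<close>. They
  converge to a nonzero value, so the scaled coefficients stay away from 0.\<close>

lemma simple_pole_coeff_lower_bound:
  fixes K :: "complex fps"
  assumes "\<zeta> \<noteq> 0" "ereal (norm \<zeta>) < fps_conv_radius (fps_of_poly [:-\<zeta>, 1:] * K)"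
    and "eval_fps (fps_of_poly [:-\<zeta>, 1:] * K) \<zeta> \<noteq> 0"
  obtains \<delta> where "\<delta> > 0" "eventually (\<lambda>n. \<delta> \<le> norm (fps_nth K n) * norm \<zeta> ^ n) sequentially"
proof -
  define G where "G = fps_of_poly [:-\<zeta>, 1:] * K"
  have G: "G = fps_X * K - fps_const \<zeta> * K"
    by (simp add: G_def fps_of_poly_linear algebra_simps flip: fps_const_neg)
  have partial: "(\<Sum>i<Suc n. fps_nth G i * \<zeta> ^ i) = - (\<zeta> ^ Suc n * fps_nth K n)" for n
    by (induction n) (simp_all add: G algebra_simps)
  have "(\<lambda>n. \<Sum>i<n. fps_nth G i * \<zeta> ^ i) \<longlonglongrightarrow> eval_fps G \<zeta>"
    using sums_eval_fps[of \<zeta> G] assms(2) by (simp add: G_def sums_def)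
  then have "(\<lambda>n. norm (\<Sum>i<Suc n. fps_nth G i * \<zeta> ^ i)) \<longlonglongrightarrow> norm (eval_fps G \<zeta>)"
    by (intro tendsto_norm LIMSEQ_Suc)
  then have "(\<lambda>n. norm \<zeta> * (norm (fps_nth K n) * norm \<zeta> ^ n)) \<longlonglongrightarrow> norm (eval_fps G \<zeta>)"
    unfolding partial by (simp add: norm_mult norm_power mult_ac)
  moreover have "norm (eval_fps G \<zeta>) / 2 < norm (eval_fps G \<zeta>)"
    using assms(3) by (simp add: G_def)
  ultimately have ev: "eventually (\<lambda>n. norm (eval_fps G \<zeta>) / 2 < norm \<zeta> * (norm (fps_nth K n) * norm \<zeta> ^ n)) sequentially"
    by (rule order_tendstoD(1))
  show thesis
  proof
    show "norm (eval_fps G \<zeta>) / 2 / norm \<zeta> > 0" using assms by (simp add: G_def)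
    show "eventually (\<lambda>n. norm (eval_fps G \<zeta>) / 2 / norm \<zeta> \<le> norm (fps_nth K n) * norm \<zeta> ^ n) sequentially"
      using ev by eventually_elim (use assms(1) in \<open>simp add: divide_le_eq mult_ac\<close>)
  qed
qed

text \<open>Turns the pole condition into facts about power series. Multiplication by
  \<open>(z - \<zeta>) ^ s\<close> removes the singularity, and the open set \<open>U\<close>
  contains a disk strictly larger than the compact one. The value at \<open>\<zeta>\<close> is
  nonzero because the order of the pole is exact.\<close>

lemma analytic_except_pole_fps:
  assumes "analytic_except_pole g \<zeta> s" "\<zeta> \<noteq> 0"
  shows "ereal (norm \<zeta>) \<le> fps_conv_radius g"
    and "ereal (norm \<zeta>) < fps_conv_radius (fps_of_poly [:-\<zeta>, 1:] ^ s * g)"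
    and "eval_fps (fps_of_poly [:-\<zeta>, 1:] ^ s * g) \<zeta> \<noteq> 0"
proof -
  from assms(1) obtain F U where U: "open U" "cball 0 (norm \<zeta>) \<subseteq> U" and F: "F holomorphic_on (U - {\<zeta>})"
    "F has_fps_expansion g" "is_pole F \<zeta>" "zorder F \<zeta> = - int s"
    unfolding analytic_except_pole_def by blast
  show "ereal (norm \<zeta>) \<le> fps_conv_radius g"
  proof (rule holomorphic_on_imp_fps_conv_radius_ge[OF F(2)])
    show "F holomorphic_on eball 0 (ereal (norm \<zeta>))"
      using F(1) by (rule holomorphic_on_subset) (use U(2) in auto)
  qed
  define h where "h = zor_poly F \<zeta>"
  have "\<zeta> \<in> U" using U(2) by auto
  then obtain r where r: "h \<zeta> \<noteq> 0" "r > 0" "cball \<zeta> r \<subseteq> U" "h holomorphic_on cball \<zeta> r"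
    "\<And>w. w \<in> cball \<zeta> r - {\<zeta>} \<Longrightarrow> F w = h w / (w - \<zeta>) ^ s"
    using zorder_exist_pole[OF F(1) U(1) _ F(3)] F(4) by (auto simp: h_def)
  define H where "H = (\<lambda>w. if w = \<zeta> then h \<zeta> else (w - \<zeta>) ^ s * F w)"
  have "H holomorphic_on ball \<zeta> r"
  proof (rule holomorphic_transform)
    show "h holomorphic_on ball \<zeta> r" using r(4) by (rule holomorphic_on_subset) auto
  qed (use r(5) in \<open>auto simp: H_def\<close>)
  moreover have "H holomorphic_on (U - {\<zeta>})"
  proof (rule holomorphic_transform)
    show "(\<lambda>w. (w - \<zeta>) ^ s * F w) holomorphic_on (U - {\<zeta>})"
      by (intro holomorphic_intros F)
  qed (auto simp: H_def)
  ultimately have "H holomorphic_on (ball \<zeta> r \<union> (U - {\<zeta>}))"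
    using U(1) by (intro holomorphic_on_Un) auto
  then have HU: "H holomorphic_on U"
    by (rule holomorphic_on_subset) (use r(2) in auto)
  have "(\<lambda>w. (w - \<zeta>) ^ s * F w) has_fps_expansion fps_of_poly [:-\<zeta>, 1:] ^ s * g"
    unfolding fps_of_poly_linear
    by (rule has_fps_expansion_schematicI, (rule fps_expansion_intros F)+) simp
  moreover have "eventually (\<lambda>w. H w = (w - \<zeta>) ^ s * F w) (nhds 0)"
  proof -
    have "eventually (\<lambda>w. w \<in> - {\<zeta>}) (nhds 0)"
      using assms(2) by (intro eventually_nhds_in_open) auto
    then show ?thesis by eventually_elim (auto simp: H_def)
  qed
  ultimately have exp: "H has_fps_expansion fps_of_poly [:-\<zeta>, 1:] ^ s * g"
    by (subst has_fps_expansion_cong) auto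
  obtain \<epsilon> where \<epsilon>: "\<epsilon> > 0" "(\<Union>x\<in>cball 0 (norm \<zeta>). ball x \<epsilon>) \<subseteq> U"
    using compact_subset_open_imp_ball_epsilon_subset[OF compact_cball U] by auto
  have "ball 0 (norm \<zeta> + \<epsilon>) \<subseteq> U"
  proof
    fix w :: complex assume w: "w \<in> ball 0 (norm \<zeta> + \<epsilon>)"
    \<comment> \<open>\<open>x\<close> is the radial projection of \<open>w\<close> to the closed
      disk, hence the point of that disk nearest to \<open>w\<close>.\<close>
    define x where "x = (if norm w \<le> norm \<zeta> then w else of_real (norm \<zeta> / norm w) * w)"
    have "dist x w < \<epsilon>"
    proof (cases "norm w \<le> norm \<zeta>")
      case False
      then have "w \<noteq> 0" by auto
      have "x - w = of_real ((norm \<zeta> - norm w) / norm w) * w"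
        using False \<open>w \<noteq> 0\<close> by (simp add: x_def field_simps)
      then have "dist x w = norm w - norm \<zeta>"
        using False \<open>w \<noteq> 0\<close> by (simp add: dist_norm norm_mult norm_divide flip: of_real_diff)
      then show ?thesis using w by simp
    qed (use \<epsilon> in \<open>simp add: x_def\<close>)
    moreover have "norm x \<le> norm \<zeta>" by (auto simp: x_def norm_mult norm_divide)
    ultimately show "w \<in> U" by (intro subsetD[OF \<epsilon>(2)] UN_I[of x]) auto
  qed
  with HU have Hb: "H holomorphic_on ball 0 (norm \<zeta> + \<epsilon>)" by (rule holomorphic_on_subset)
  then have "ereal (norm \<zeta> + \<epsilon>) \<le> fps_conv_radius (fps_of_poly [:-\<zeta>, 1:] ^ s * g)"
    using exp by (intro holomorphic_on_imp_fps_conv_radius_ge) auto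
  then show "ereal (norm \<zeta>) < fps_conv_radius (fps_of_poly [:-\<zeta>, 1:] ^ s * g)"
    using \<epsilon>(1) by (auto elim!: order.strict_trans2[rotated])
  have "eval_fps (fps_of_poly [:-\<zeta>, 1:] ^ s * g) \<zeta> = H \<zeta>"
    using has_fps_expansion_imp_eval_fps_eq[OF exp _ Hb] \<epsilon>(1) by simp
  then show "eval_fps (fps_of_poly [:-\<zeta>, 1:] ^ s * g) \<zeta> \<noteq> 0"
    using r(1) by (simp add: H_def)
qed

section \<open>Coefficient sums of polynomials with near and far zeros\<close>

lemma sum_norm_coeff_linear_mult_le:
  fixes P :: "complex poly"
  shows "(\<Sum>j\<le>D. norm (coeff ([:-x, 1:] * P) j)) \<le> (1 + norm x) * (\<Sum>j\<le>D. norm (coeff P j))"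
proof -
  have c: "coeff ([:-x, 1:] * P) j = (case j of 0 \<Rightarrow> 0 | Suc i \<Rightarrow> coeff P i) - x * coeff P j" for j
    by (simp add: coeff_pCons split: nat.split)
  have "(\<Sum>j\<le>D. norm (coeff ([:-x, 1:] * P) j))
      \<le> (\<Sum>j\<le>D. norm (case j of 0 \<Rightarrow> 0 | Suc i \<Rightarrow> coeff P i) + norm x * norm (coeff P j))"
    unfolding c by (intro sum_mono order_trans[OF norm_triangle_ineq4]) (simp add: norm_mult)
  also have "\<dots> = (\<Sum>j\<le>D. norm (case j of 0 \<Rightarrow> 0 | Suc i \<Rightarrow> coeff P i)) + norm x * (\<Sum>j\<le>D. norm (coeff P j))"
    by (simp add: sum.distrib sum_distrib_left)
  also have "(\<Sum>j\<le>D. norm (case j of 0 \<Rightarrow> 0 | Suc i \<Rightarrow> coeff P i)) = (\<Sum>i<D. norm (coeff P i))"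
    by (simp add: sum.atMost_shift)
  also have "\<dots> \<le> (\<Sum>j\<le>D. norm (coeff P j))" by (intro sum_mono2) auto
  finally show ?thesis by (simp add: algebra_simps)
qed

text \<open>Division by a factor whose zero is far from 0: the coefficients of \<open>P\<close> are
  recovered from index 0 upwards, each from the previous one and one coefficient of the product.
  Indices above \<open>k\<close> never enter. Each step costs a factor \<open>1 / \<epsilon>\<close>
  and one more copy of the sum on the right.\<close>

lemma sum_norm_coeff_divide_linear_le:
  fixes P :: "complex poly"
  assumes "0 < \<epsilon>" "\<epsilon> \<le> 1" "\<epsilon> \<le> norm x" "j \<le> k"
  shows "norm x * \<epsilon> ^ j * (\<Sum>i\<le>j. norm (coeff P i)) \<le> real (Suc j) * (\<Sum>i\<le>k. norm (coeff ([:-x, 1:] * P) i))"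
  using assms(4)
proof (induction j)
  case 0
  have "norm x * norm (coeff P 0) = norm (coeff ([:-x, 1:] * P) 0)" by (simp add: norm_mult)
  also have "\<dots> \<le> (\<Sum>i\<le>k. norm (coeff ([:-x, 1:] * P) i))"
    by (rule member_le_sum) auto
  finally show ?case by simp
next
  case (Suc j)
  define T where "T = (\<Sum>i\<le>k. norm (coeff ([:-x, 1:] * P) i))"
  define t where "t = (\<Sum>i\<le>j. norm (coeff P i))"
  have t0: "t \<ge> 0" by (simp add: t_def sum_nonneg)
  have "norm x * (\<Sum>i\<le>Suc j. norm (coeff P i)) = (\<Sum>i\<le>Suc j. norm (x * coeff P i))"
    by (simp add: norm_mult sum_distrib_left distrib_left)
  also have "\<dots> \<le> (\<Sum>i\<le>Suc j. norm (coeff ([:-x, 1:] * P) i) + norm (case i of 0 \<Rightarrow> 0 | Suc i \<Rightarrow> coeff P i))"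
  proof (rule sum_mono)
    fix i
    have "x * coeff P i = (case i of 0 \<Rightarrow> 0 | Suc i \<Rightarrow> coeff P i) - coeff ([:-x, 1:] * P) i"
      by (simp add: coeff_pCons split: nat.split)
    then show "norm (x * coeff P i) \<le> norm (coeff ([:-x, 1:] * P) i) + norm (case i of 0 \<Rightarrow> 0 | Suc i \<Rightarrow> coeff P i)"
      by (metis add.commute norm_triangle_ineq4)
  qed
  also have "\<dots> = (\<Sum>i\<le>Suc j. norm (coeff ([:-x, 1:] * P) i)) + t"
    unfolding sum.distrib t_def by (subst (2) sum.atMost_Suc_shift) simp
  also have "(\<Sum>i\<le>Suc j. norm (coeff ([:-x, 1:] * P) i)) \<le> T"
    unfolding T_def using Suc.prems by (intro sum_mono2) auto
  finally have 1: "norm x * (\<Sum>i\<le>Suc j. norm (coeff P i)) \<le> T + t" by simp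
  \<comment> \<open>One factor \<open>\<epsilon>\<close> is traded for \<open>norm x\<close> to
    match the induction hypothesis.\<close>
  have "\<epsilon> ^ Suc j * t \<le> norm x * \<epsilon> ^ j * t"
    using assms t0 by (auto intro!: mult_right_mono)
  also have "\<dots> \<le> real (Suc j) * T"
    using Suc by (simp add: T_def t_def)
  finally have 2: "\<epsilon> ^ Suc j * t \<le> real (Suc j) * T" .
  have "T \<ge> 0" by (simp add: T_def sum_nonneg)
  have "norm x * \<epsilon> ^ Suc j * (\<Sum>i\<le>Suc j. norm (coeff P i)) = \<epsilon> ^ Suc j * (norm x * (\<Sum>i\<le>Suc j. norm (coeff P i)))"
    by (simp only: mult_ac)
  also have "\<dots> \<le> \<epsilon> ^ Suc j * (T + t)"
    using 1 assms by (intro mult_left_mono) auto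
  also have "\<dots> \<le> 1 * T + \<epsilon> ^ Suc j * t"
    unfolding distrib_left using assms \<open>T \<ge> 0\<close> t0
    by (intro add_mono mult_right_mono power_le_one) auto
  also have "\<dots> \<le> real (Suc (Suc j)) * T"
    using 2 by (simp add: algebra_simps)
  finally show ?case by (simp add: T_def)
qed

lemma sum_norm_coeff_prod_near_le:
  fixes A :: "complex multiset"
  assumes "\<And>x. x \<in># A \<Longrightarrow> norm x \<le> 1"
  shows "(\<Sum>j\<le>D. norm (coeff (\<Prod>x\<in>#A. [:-x, 1:]) j)) \<le> 2 ^ size A"
  using assms
proof (induction A)
  case empty
  have "(\<Sum>j\<le>D. norm (coeff (1 :: complex poly) j)) = (\<Sum>j\<in>{0}. norm (coeff (1 :: complex poly) j))"
    by (rule sum.mono_neutral_right) (auto simp: coeff_1)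
  then show ?case by simp
next
  case (add x A)
  have "(\<Sum>j\<le>D. norm (coeff (\<Prod>x\<in>#add_mset x A. [:-x, 1:]) j))
    \<le> (1 + norm x) * (\<Sum>j\<le>D. norm (coeff (\<Prod>x\<in>#A. [:-x, 1:]) j))"
    using sum_norm_coeff_linear_mult_le by simp
  also have "\<dots> \<le> 2 * 2 ^ size A"
    using add by (intro mult_mono) (auto simp: sum_nonneg)
  finally show ?case by simp
qed

lemma monic_prod_linear:
  fixes A :: "complex multiset"
  shows "coeff (\<Prod>x\<in>#A. [:-x, 1:]) (size A) = 1" and "degree (\<Prod>x\<in>#A. [:-x, 1:]) = size A"
proof -
  have l: "lead_coeff (\<Prod>x\<in>#A. [:-x, 1:]) = 1" for A :: "complex multiset"
    by (induction A) (auto simp: lead_coeff_mult simp del: mult_pCons_left)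
  have nz: "(\<Prod>x\<in>#A. [:-x, 1:]) \<noteq> 0" for A :: "complex multiset"
    using l[of A] by force
  show d: "degree (\<Prod>x\<in>#A. [:-x, 1:]) = size A" for A :: "complex multiset"
  proof (induction A)
    case (add x A)
    have "degree ([:-x, 1:] * (\<Prod>x\<in>#A. [:-x, 1:])) = degree [:-x, 1:] + degree (\<Prod>x\<in>#A. [:-x, 1:])"
      using nz[of A] by (intro degree_mult_eq) auto
    with add show ?case by simp
  qed simp
  show "coeff (\<Prod>x\<in>#A. [:-x, 1:]) (size A) = 1" using l[of A] by (simp add: d)
qed

text \<open>
  Each far zero changes the ratio of the two sums by a factor bounded below, and for the near zeros
  alone the sum of the low coefficients contains the leading coefficient.
\<close>
lemma low_coeffs_lower_bound:
  fixes A B :: "complex multiset"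
  assumes \<epsilon>: "0 < \<epsilon>" "\<epsilon> \<le> 1"
    and A: "\<And>x. x \<in># A \<Longrightarrow> norm x < \<epsilon>" and B: "\<And>x. x \<in># B \<Longrightarrow> \<epsilon> \<le> norm x"
  defines "k \<equiv> size A"
  shows "(\<epsilon> ^ Suc k / (2 * Suc k)) ^ size B / 2 ^ k * (\<Sum>j\<le>D. norm (coeff (\<Prod>x\<in>#A + B. [:-x, 1:]) j))
     \<le> (\<Sum>j\<le>k. norm (coeff (\<Prod>x\<in>#A + B. [:-x, 1:]) j))"
  using B
proof (induction B)
  case empty
  have "(\<Sum>j\<le>D. norm (coeff (\<Prod>x\<in>#A. [:-x, 1:]) j)) \<le> 2 ^ k"
    unfolding k_def using A \<epsilon> by (intro sum_norm_coeff_prod_near_le) (meson less_le_trans less_imp_le)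
  then have "(\<Sum>j\<le>D. norm (coeff (\<Prod>x\<in>#A. [:-x, 1:]) j)) / 2 ^ k \<le> 1" by simp
  also have "1 = norm (coeff (\<Prod>x\<in>#A. [:-x, 1:]) k)"
    unfolding k_def monic_prod_linear by simp
  also have "\<dots> \<le> (\<Sum>j\<le>k. norm (coeff (\<Prod>x\<in>#A. [:-x, 1:]) j))"
    by (rule member_le_sum) auto
  finally show ?case by simp
next
  case (add x B)
  define P where "P = (\<Prod>x\<in>#A + B. [:-x, 1:])"
  define e where "e = \<epsilon> ^ Suc k / (2 * Suc k)"
  define S T S' T' where "S = (\<Sum>j\<le>D. norm (coeff P j))" and "T = (\<Sum>j\<le>k. norm (coeff P j))"
    and "S' = (\<Sum>j\<le>D. norm (coeff ([:-x, 1:] * P) j))" and "T' = (\<Sum>j\<le>k. norm (coeff ([:-x, 1:] * P) j))"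
  have eq: "(\<Prod>x\<in>#A + add_mset x B. [:-x, 1:]) = [:-x, 1:] * P"
    by (simp add: P_def)
  have e0: "e \<ge> 0" using \<epsilon> by (simp add: e_def)
  have x: "\<epsilon> \<le> norm x" and IH: "e ^ size B / 2 ^ k * S \<le> T"
    using add by (auto simp: e_def S_def T_def P_def)
  have nn: "S \<ge> 0" "T \<ge> 0" by (auto simp: S_def T_def sum_nonneg)
  \<comment> \<open>A far zero enlarges the full sum by at most \<open>1 + norm x\<close>, while the
    low sum gains a factor proportional to \<open>norm x\<close>. Since
    \<open>\<epsilon> * (1 + norm x) \<le> 2 * norm x\<close>, the quotient is bounded below however
    large \<open>x\<close> is; this is the origin of the 2 in \<open>e\<close>.\<close>
  have "e * (1 + norm x) \<le> norm x * \<epsilon> ^ k / Suc k"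
  proof -
    have "\<epsilon> * (1 + norm x) \<le> 2 * norm x"
      using x \<epsilon> mult_right_mono[of \<epsilon> 1 "norm x"] by (simp add: algebra_simps)
    then have "\<epsilon> ^ k * (\<epsilon> * (1 + norm x)) \<le> \<epsilon> ^ k * (2 * norm x)"
      using \<epsilon> by (intro mult_left_mono) auto
    then have "\<epsilon> ^ k * (\<epsilon> * (1 + norm x)) / (2 * Suc k) \<le> \<epsilon> ^ k * (2 * norm x) / (2 * Suc k)"
      by (intro divide_right_mono) auto
    also have "\<dots> = norm x * \<epsilon> ^ k / Suc k"
      by (simp add: field_simps)
    finally show ?thesis by (simp add: e_def mult_ac)
  qed
  then have "e * (1 + norm x) * T \<le> norm x * \<epsilon> ^ k / Suc k * T"
    using nn(2) by (rule mult_right_mono)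
  also have "\<dots> \<le> T'"
    using sum_norm_coeff_divide_linear_le[OF \<epsilon> x order_refl, of k P]
    by (simp add: T_def T'_def field_simps)
  finally have 2: "e * (1 + norm x) * T \<le> T'" .
  have "e ^ size (add_mset x B) / 2 ^ k * S' \<le> e ^ size (add_mset x B) / 2 ^ k * ((1 + norm x) * S)"
    using e0 sum_norm_coeff_linear_mult_le[of x P D] by (intro mult_left_mono) (auto simp: S_def S'_def)
  also have "\<dots> = e * (1 + norm x) * (e ^ size B / 2 ^ k * S)" by simp
  also have "\<dots> \<le> e * (1 + norm x) * T"
    using IH e0 by (intro mult_left_mono) auto
  also note 2
  finally show ?case unfolding eq e_def S'_def T'_def .
qed

section \<open>Counting near zeros and bounding \<open>pole_mu\<close>\<close>

text \<open>In the sorted list of distances the entries below \<open>\<epsilon>\<close> form an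
  initial segment. If position \<open>\<nu> - 1\<close> (counted from 0) were outside it, there
  would be at most \<open>\<nu> - 1\<close> such entries.\<close>

lemma zero_dist_less:
  assumes "\<nu> \<ge> 1" "\<nu> \<le> size (filter_mset (\<lambda>z. norm (\<zeta> - z) < \<epsilon>) (proots Q))"
  shows "zero_dist \<zeta> Q \<nu> < \<epsilon>"
proof -
  define ds where "ds = sorted_list_of_multiset (image_mset (\<lambda>z. cmod (\<zeta> - z)) (proots Q))"
  have s: "sorted ds" unfolding ds_def by (rule sorted_sorted_list_of_multiset)
  have "size (filter_mset (\<lambda>z. norm (\<zeta> - z) < \<epsilon>) (proots Q))
    = size (filter_mset (\<lambda>t. t < \<epsilon>) (image_mset (\<lambda>z. cmod (\<zeta> - z)) (proots Q)))"
    by (simp add: filter_mset_image_mset)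
  also have "\<dots> = size (filter_mset (\<lambda>t. t < \<epsilon>) (mset ds))" by (simp add: ds_def)
  also have "\<dots> = length (filter (\<lambda>t. t < \<epsilon>) ds)" by (simp flip: mset_filter)
  finally have len: "\<nu> \<le> length (filter (\<lambda>t. t < \<epsilon>) ds)" using assms(2) by simp
  then have \<nu>: "\<nu> \<le> length ds" by (meson length_filter_le order_trans)
  have "ds ! (\<nu> - 1) < \<epsilon>"
  proof (rule ccontr)
    assume "\<not> ds ! (\<nu> - 1) < \<epsilon>"
    then have "i < \<nu> - 1" if "i < length ds" "ds ! i < \<epsilon>" for i
      using sorted_nth_mono[OF s, of "\<nu> - 1" i] that by force
    then have "{i. i < length ds \<and> ds ! i < \<epsilon>} \<subseteq> {..<\<nu> - 1}" by auto
    then have "card {i. i < length ds \<and> ds ! i < \<epsilon>} \<le> \<nu> - 1"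
      using card_mono[of "{..<\<nu> - 1}"] by auto
    then show False using len assms(1) by (simp add: length_filter_conv_card)
  qed
  then show ?thesis using \<nu> by (simp add: zero_dist_def Let_def flip: ds_def)
qed

text \<open>The degree bound makes the definite description meaningful. Its second clause, a rate at
  least 1 at \<open>pole_mu Q \<zeta> + 1\<close>, contradicts monotonicity if that index is at most
  \<open>\<tau>\<close>.\<close>

lemma pole_mu_geI:
  assumes "eventually (\<lambda>n. degree (Q n) \<le> M) sequentially" "zero_rate Q \<zeta> \<tau> < 1"
  shows "pole_mu Q \<zeta> \<ge> \<tau>"
proof (rule ccontr)
  assume "\<not> pole_mu Q \<zeta> \<ge> \<tau>"
  then have "zero_rate Q \<zeta> (pole_mu Q \<zeta> + 1) < 1"
    by (intro zero_rate_less_1_mono[OF assms(2)]) auto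
  moreover have "zero_rate Q \<zeta> (pole_mu Q \<zeta> + 1) \<ge> 1"
    using theI'[OF pole_mu_ex1[OF assms(1), of \<zeta>]] unfolding pole_mu_def by blast
  ultimately show False by (meson leD)
qed

section \<open>The vanishing coefficient of a reduced approximant\<close>

text \<open>The cancelled factor \<open>h\<close> may vanish at 0. If it does so to order
  \<open>l\<close>, the order of contact drops by \<open>l\<close>, but the degrees of the
  numerators drop by \<open>degree h \<ge> l\<close>. The index \<open>N = n - l\<close> therefore
  lies in the gap between degree and order, and it is the same for all admissible
  \<open>p\<close>.\<close>

lemma hermite_pade_coeff_zero:
  assumes "hermite_pade_denominator d f m n Q" "\<And>k. k \<in> {1..d} \<Longrightarrow> m k \<le> n"
  defines "M \<equiv> \<Sum>k=1..d. m k"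
  shows "lead_coeff Q = 1" "degree Q \<le> M"
    and "M \<le> n \<Longrightarrow> \<exists>N\<le>n. n \<le> N + M \<and> (\<forall>p. (\<forall>k\<in>{1..d}. if m k = 0 then p k = 0 else degree (p k) < m k) \<longrightarrow>
            fps_nth (fps_of_poly Q * (\<Sum>k=1..d. fps_of_poly (p k) * f k)) N = 0)"
proof -
  obtain p q P where sol: "hermite_pade_solution d f m n p q" and "reduced_form d p q P Q"
    using assms(1) by (auto simp: hermite_pade_denominator_def)
  then obtain h where h: "h \<noteq> 0" "q = h * Q" "\<And>k. k \<in> {1..d} \<Longrightarrow> p k = h * P k"
    and monic: "lead_coeff Q = 1"
    by (auto simp: reduced_form_def)
  show "lead_coeff Q = 1" by fact
  have nz: "Q \<noteq> 0" using monic by auto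
  have "degree q \<le> M" using sol by (simp add: hermite_pade_solution_def M_def)
  moreover have "degree q = degree h + degree Q"
    unfolding h(2) using h(1) nz by (rule degree_mult_eq)
  ultimately have deg: "degree h + degree Q \<le> M" by simp
  then show "degree Q \<le> M" by simp
  define H where "H = fps_of_poly h"
  have Hnz: "H \<noteq> 0" using h(1) fps_of_poly_eq_iff[of h 0] by (simp add: H_def)
  define l where "l = subdegree H"
  have l: "l \<le> degree h"
    unfolding l_def H_def using h(1) by (intro subdegree_leI) simp
  assume n: "M \<le> n"
  \<comment> \<open>Order side of the gap: \<open>E\<close> times \<open>h\<close> has order above
    \<open>n\<close>, so \<open>E\<close> itself has order above \<open>n - l\<close>.\<close>
  have res: "fps_nth (fps_of_poly r * (fps_of_poly Q * f k - fps_of_poly (P k))) (n - l) = 0"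
    if k: "k \<in> {1..d}" for k r
  proof (cases "fps_of_poly Q * f k - fps_of_poly (P k) = 0")
    case False
    define E where "E = fps_of_poly Q * f k - fps_of_poly (P k)"
    have "fps_of_poly q * f k - fps_of_poly (p k) = H * E"
      using h(2) h(3)[OF k] by (simp add: E_def H_def fps_of_poly_mult algebra_simps)
    then have z: "fps_nth (H * E) j = 0" if "j \<le> n" for j
      using sol k that by (metis hermite_pade_solution_def)
    have "H * E \<noteq> 0" using Hnz False by (simp add: E_def)
    then have "n < subdegree (H * E)"
      using z by (metis not_le nth_subdegree_nonzero)
    then have "n < l + subdegree E"
      using Hnz False by (simp add: E_def l_def)
    then have "n - l < subdegree E"
      using deg l n by linarith
    then show ?thesis
      unfolding E_def[symmetric] by (intro fps_mult_nth_outside_subdegrees(2))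
  qed simp
  \<comment> \<open>Degree side of the gap: the degree of \<open>r * P k\<close> is at most
    \<open>(m k - 1) + (n - m k - degree h)\<close>, which is below \<open>n - l\<close>.\<close>
  have low: "fps_nth (fps_of_poly (r * P k)) (n - l) = 0"
    if k: "k \<in> {1..d}" and r: "if m k = 0 then r = 0 else degree r < m k" for k and r :: "complex poly"
  proof (cases "r = 0 \<or> P k = 0")
    case False
    then have "degree h + degree (P k) \<le> n - m k"
      using sol k h(1) h(3)[OF k] unfolding hermite_pade_solution_def by (metis degree_mult_eq)
    moreover have "degree (r * P k) \<le> degree r + degree (P k)" by (rule degree_mult_le)
    moreover have "degree r < m k" using r False by (auto split: if_splits)
    ultimately have "degree (r * P k) < n - l"
      using l deg n assms(2)[OF k] by linarith
    then show ?thesis by (simp add: coeff_eq_0)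
  qed auto
  show "\<exists>N\<le>n. n \<le> N + M \<and> (\<forall>p. (\<forall>k\<in>{1..d}. if m k = 0 then p k = 0 else degree (p k) < m k) \<longrightarrow>
            fps_nth (fps_of_poly Q * (\<Sum>k=1..d. fps_of_poly (p k) * f k)) N = 0)"
  proof (intro exI[of _ "n - l"] conjI allI impI)
    show "n \<le> n - l + M" using l deg by linarith
    fix r :: "nat \<Rightarrow> complex poly" assume r: "\<forall>k\<in>{1..d}. if m k = 0 then r k = 0 else degree (r k) < m k"
    have "fps_of_poly Q * (\<Sum>k=1..d. fps_of_poly (r k) * f k)
      = (\<Sum>k=1..d. fps_of_poly (r k) * (fps_of_poly Q * f k - fps_of_poly (P k)) + fps_of_poly (r k * P k))"
      by (simp add: sum_distrib_left fps_of_poly_mult algebra_simps)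
    then show "fps_nth (fps_of_poly Q * (\<Sum>k=1..d. fps_of_poly (r k) * f k)) (n - l) = 0"
      using res low r by (simp add: fps_sum_nth)
  qed auto
qed

section \<open>Taylor coefficients of the denominators at \<open>\<zeta>\<close>\<close>

lemma poly_taylor:
  fixes P :: "complex poly"
  assumes "degree P \<le> D"
  shows "P = (\<Sum>j\<le>D. smult (coeff (pcompose P [:\<zeta>, 1:]) j) ([:-\<zeta>, 1:] ^ j))"
proof -
  have "degree (pcompose P [:\<zeta>, 1:]) \<le> D" using assms by (simp add: degree_pcompose)
  then have "pcompose P [:\<zeta>, 1:] = (\<Sum>j\<le>D. monom (coeff (pcompose P [:\<zeta>, 1:]) j) j)"
    by (simp add: poly_as_sum_of_monoms')
  then have "poly (pcompose P [:\<zeta>, 1:]) (x - \<zeta>)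
      = poly (\<Sum>j\<le>D. monom (coeff (pcompose P [:\<zeta>, 1:]) j) j) (x - \<zeta>)" for x
    by simp
  then have "poly P x = poly (\<Sum>j\<le>D. smult (coeff (pcompose P [:\<zeta>, 1:]) j) ([:-\<zeta>, 1:] ^ j)) x" for x
    by (simp add: poly_pcompose poly_sum poly_monom)
  then show ?thesis by (simp add: poly_eq_poly_eq_iff[symmetric] fun_eq_iff)
qed

text \<open>The vanishing coefficient is solved for the term with \<open>j = s\<close>. Terms with
  \<open>j < s\<close> are small by hypothesis despite subexponential growth of \<open>a j\<close>;
  for \<open>j > s\<close> the factor \<open>a j\<close> is itself small. Dividing by
  \<open>S n\<close> bounds all Taylor coefficients by 1, whatever the size of
  \<open>Q n\<close>.\<close>

lemma taylor_coeff_exp_small_step: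
  fixes Q :: "nat \<Rightarrow> complex poly" and \<zeta> :: complex and M :: nat
  defines "c \<equiv> \<lambda>n j. coeff (pcompose (Q n) [:\<zeta>, 1:]) j"
  defines "S \<equiv> \<lambda>n. \<Sum>j\<le>M. norm (c n j)"
  assumes \<zeta>: "\<zeta> \<noteq> 0" and deg: "eventually (\<lambda>n. degree (Q n) \<le> M) sequentially"
    and N: "eventually (\<lambda>n. N n \<le> n) sequentially" "eventually (\<lambda>n. n \<le> N n + M) sequentially"
    and zero: "eventually (\<lambda>n. fps_nth (fps_of_poly (Q n) * g) (N n) = 0) sequentially"
    and pole: "analytic_except_pole g \<zeta> (Suc s)"
    and small: "\<And>j. j < s \<Longrightarrow> exp_small (\<lambda>n. norm (c n j) / S n)"
  shows "exp_small (\<lambda>n. norm (c n s) / S n)"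
proof -
  define K where "K = (\<lambda>j. fps_of_poly [:-\<zeta>, 1:] ^ j * g)"
  define a where "a = (\<lambda>j n. norm (fps_nth (K j) (N n)) * norm \<zeta> ^ N n)"
  note P = analytic_except_pole_fps[OF pole \<zeta>]
  have \<zeta>0: "0 < norm \<zeta>" using \<zeta> by simp
  have radius: "ereal (norm \<zeta>) \<le> fps_conv_radius (K j)" for j
    unfolding K_def fps_of_poly_power[symmetric] using P(1)
    by (intro fps_conv_radius_mult_ge) auto
  have radius': "ereal (norm \<zeta>) < fps_conv_radius (K j)" if "j > s" for j
  proof -
    have "K j = fps_of_poly ([:-\<zeta>, 1:] ^ (j - Suc s)) * (fps_of_poly [:-\<zeta>, 1:] ^ Suc s * g)"
      using that unfolding K_def fps_of_poly_power mult.assoc[symmetric] power_add[symmetric] by simp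
    moreover have "fps_conv_radius (fps_of_poly [:-\<zeta>, 1:] ^ Suc s * g)
        \<le> fps_conv_radius (fps_of_poly ([:-\<zeta>, 1:] ^ (j - Suc s)) * (fps_of_poly [:-\<zeta>, 1:] ^ Suc s * g))"
      by (rule fps_conv_radius_mult_ge) auto
    ultimately show ?thesis using P(2) by (metis less_le_trans)
  qed
  \<comment> \<open>\<open>K s\<close> retains exactly a simple pole at \<open>\<zeta>\<close>,
    which yields the lower bound for \<open>a s\<close>.\<close>
  have "fps_of_poly [:-\<zeta>, 1:] ^ Suc s * g = fps_of_poly [:-\<zeta>, 1:] * K s"
    by (simp add: K_def mult_ac)
  then obtain \<delta> where \<delta>: "\<delta> > 0"
    "eventually (\<lambda>n. \<delta> \<le> norm (fps_nth (K s) n) * norm \<zeta> ^ n) sequentially"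
    using simple_pole_coeff_lower_bound[OF \<zeta>, of "K s"] P(2,3) by metis
  have "filterlim N at_top sequentially"
    unfolding filterlim_at_top
  proof
    fix Z show "eventually (\<lambda>n. Z \<le> N n) sequentially"
      using N(2) eventually_ge_at_top[of "Z + M"] by eventually_elim linarith
  qed
  then have \<delta>': "eventually (\<lambda>n. \<delta> \<le> a s n) sequentially"
    unfolding a_def by (rule eventually_compose_filterlim[OF \<delta>(2)])
  have S0: "S n \<ge> 0" for n by (simp add: S_def sum_nonneg)
  have small_term: "exp_small (\<lambda>n. norm (c n j) / S n * a j n)" if "j \<noteq> s" for j
  proof (cases "j < s")
    case True
    then show ?thesis
      unfolding a_def using exp_small_mult_fps_coeff[OF \<zeta>0 radius N(1) small] by blast
  next
    case False
    then have "exp_small (a j)"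
      unfolding a_def using fps_coeff_exp_small[OF \<zeta>0 radius' N(2)] that by simp
    moreover have "eventually (\<lambda>n. \<bar>norm (c n j) / S n * a j n\<bar> \<le> 1 * \<bar>a j n\<bar>) sequentially"
      using deg
    proof eventually_elim
      case (elim n)
      have "norm (c n j) \<le> S n"
      proof (cases "j \<le> M")
        case True
        then show ?thesis unfolding S_def by (intro member_le_sum) auto
      next
        case False
        then have "c n j = 0"
          unfolding c_def using elim by (intro coeff_eq_0) (simp add: degree_pcompose)
        then show ?thesis using S0 by simp
      qed
      \<comment> \<open>The case \<open>S n = 0\<close> is covered by the convention that division
        by 0 gives 0.\<close>
      then have "norm (c n j) / S n \<le> 1" using S0[of n] by (auto intro: divide_le_eq_1[THEN iffD2] simp: divide_le_eq)
      then show ?case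
        using S0[of n] unfolding abs_mult by (intro mult_right_mono) auto
    qed
    ultimately show ?thesis by (rule exp_small_mono)
  qed
  \<comment> \<open>The upper limit \<open>M + s\<close> keeps the index \<open>s\<close> in range
    even if \<open>s > M\<close>; coefficients beyond \<open>M\<close> eventually vanish.\<close>
  define J where "J = {..M + s} - {s}"
  have "exp_small (\<lambda>n. \<Sum>j\<in>J. norm (c n j) / S n * a j n)"
    by (intro exp_small_sum small_term) (auto simp: J_def)
  then show ?thesis
  proof (rule exp_small_mono)
    show "eventually (\<lambda>n. \<bar>norm (c n s) / S n\<bar> \<le> 1 / \<delta> * \<bar>\<Sum>j\<in>J. norm (c n j) / S n * a j n\<bar>) sequentially"
      using zero deg \<delta>'
    proof eventually_elim
      case (elim n)
      have "fps_of_poly (Q n) * g = (\<Sum>j\<le>M + s. fps_const (c n j) * K j)"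
        using elim by (subst poly_taylor[of "Q n" "M + s" \<zeta>])
          (auto simp: c_def K_def fps_of_poly_sum fps_of_poly_smult fps_of_poly_power sum_distrib_right mult.assoc)
      then have "0 = (\<Sum>j\<le>M + s. c n j * fps_nth (K j) (N n))"
        using elim by (simp add: fps_sum_nth)
      also have "\<dots> = c n s * fps_nth (K s) (N n) + (\<Sum>j\<in>J. c n j * fps_nth (K j) (N n))"
        unfolding J_def by (intro sum.remove) auto
      finally have "norm (c n s * fps_nth (K s) (N n)) = norm (\<Sum>j\<in>J. c n j * fps_nth (K j) (N n))"
        by (metis add_eq_0_iff norm_minus_cancel)
      also have "\<dots> \<le> (\<Sum>j\<in>J. norm (c n j) * norm (fps_nth (K j) (N n)))"
        by (rule order_trans[OF norm_sum]) (simp add: norm_mult)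
      finally have "norm (c n s * fps_nth (K s) (N n)) * (norm \<zeta> ^ N n / S n)
        \<le> (\<Sum>j\<in>J. norm (c n j) * norm (fps_nth (K j) (N n))) * (norm \<zeta> ^ N n / S n)"
        using S0 by (intro mult_right_mono) auto
      then have le: "norm (c n s) / S n * a s n \<le> (\<Sum>j\<in>J. norm (c n j) / S n * a j n)"
        by (simp add: a_def norm_mult sum_distrib_left sum_divide_distrib mult_ac)
      have "\<delta> * (norm (c n s) / S n) \<le> norm (c n s) / S n * a s n"
        using elim S0[of n] by (subst mult.commute, intro mult_left_mono) auto
      also note le
      finally have "norm (c n s) / S n \<le> 1 / \<delta> * (\<Sum>j\<in>J. norm (c n j) / S n * a j n)"
        using \<delta>(1) by (simp add: field_simps)
      also have "\<dots> \<le> 1 / \<delta> * \<bar>\<Sum>j\<in>J. norm (c n j) / S n * a j n\<bar>"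
        using \<delta>(1) by (intro mult_left_mono) auto
      finally show ?case using S0[of n] by simp
    qed
  qed
qed

section \<open>From small Taylor coefficients to near zeros\<close>

text \<open>Translation by \<open>\<zeta>\<close> moves the zeros to the differences
  \<open>z - \<zeta>\<close>. With fewer than \<open>\<tau>\<close> near ones, the low coefficients
  in \<open>low_coeffs_lower_bound\<close> are among those of index below \<open>\<tau>\<close>, and
  their sum cannot be small.\<close>

lemma near_zeros_of_small_coeffs:
  fixes Q :: "complex poly"
  assumes "lead_coeff Q = 1" "degree Q \<le> M" "0 < \<epsilon>" "\<epsilon> \<le> 1"
    and small: "(\<Sum>j<\<tau>. norm (coeff (pcompose Q [:\<zeta>, 1:]) j))
      < (\<epsilon> ^ Suc M / (2 * Suc M)) ^ M / 2 ^ M * (\<Sum>j\<le>M. norm (coeff (pcompose Q [:\<zeta>, 1:]) j))"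
  shows "\<tau> \<le> size (filter_mset (\<lambda>z. norm (\<zeta> - z) < \<epsilon>) (proots Q))"
proof (rule ccontr)
  define A where "A = filter_mset (\<lambda>x. norm x < \<epsilon>) (image_mset (\<lambda>z. z - \<zeta>) (proots Q))"
  define B where "B = filter_mset (\<lambda>x. \<not> norm x < \<epsilon>) (image_mset (\<lambda>z. z - \<zeta>) (proots Q))"
  define S where "S = (\<Sum>j\<le>M. norm (coeff (pcompose Q [:\<zeta>, 1:]) j))"
  have AB: "A + B = image_mset (\<lambda>z. z - \<zeta>) (proots Q)"
    unfolding A_def B_def by (simp flip: multiset_partition)
  have "pcompose (\<Prod>x\<in>#R. [:-x, 1:]) [:\<zeta>, 1:] = (\<Prod>x\<in>#image_mset (\<lambda>z. z - \<zeta>) R. [:-x, 1:])" for R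
    by (induction R) (simp_all add: pcompose_mult pcompose_pCons pcompose_1 del: mult_pCons_left)
  then have Q: "pcompose Q [:\<zeta>, 1:] = (\<Prod>x\<in>#A + B. [:-x, 1:])"
    using complex_poly_decompose_multiset[of Q] assms(1) unfolding AB by (metis smult_1_left)
  assume "\<not> \<tau> \<le> size (filter_mset (\<lambda>z. norm (\<zeta> - z) < \<epsilon>) (proots Q))"
  then have k: "size A < \<tau>"
    by (simp add: A_def filter_mset_image_mset norm_minus_commute)
  have "size A + size B \<le> M"
    using assms(2) size_proots_le[of Q] arg_cong[OF AB, of size] by simp
  then have sz: "size A \<le> M" "size B \<le> M" by auto
  \<comment> \<open>The constant is weakened by replacing both numbers of zeros by \<open>M\<close>,
    so that it depends only on \<open>\<epsilon>\<close> and \<open>M\<close>.\<close>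
  have e: "\<epsilon> ^ Suc M / (2 * Suc M) \<le> \<epsilon> ^ Suc (size A) / (2 * Suc (size A))"
    using assms sz by (intro frac_le power_decreasing) auto
  have "\<epsilon> ^ Suc (size A) \<le> 1" using assms by (intro power_le_one) auto
  then have e1: "\<epsilon> ^ Suc (size A) / (2 * Suc (size A)) \<le> 1"
    by (subst divide_le_eq_1) auto
  have "(\<epsilon> ^ Suc M / (2 * Suc M)) ^ M \<le> (\<epsilon> ^ Suc (size A) / (2 * Suc (size A))) ^ M"
    using e assms by (intro power_mono) auto
  also have "\<dots> \<le> (\<epsilon> ^ Suc (size A) / (2 * Suc (size A))) ^ size B"
    using e1 sz assms by (intro power_decreasing) auto
  finally have "(\<epsilon> ^ Suc M / (2 * Suc M)) ^ M / 2 ^ M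
      \<le> (\<epsilon> ^ Suc (size A) / (2 * Suc (size A))) ^ size B / 2 ^ size A"
    using sz assms by (intro frac_le power_increasing) auto
  then have "(\<epsilon> ^ Suc M / (2 * Suc M)) ^ M / 2 ^ M * S
      \<le> (\<epsilon> ^ Suc (size A) / (2 * Suc (size A))) ^ size B / 2 ^ size A * S"
    by (rule mult_right_mono) (simp add: S_def sum_nonneg)
  also have "\<dots> \<le> (\<Sum>j\<le>size A. norm (coeff (pcompose Q [:\<zeta>, 1:]) j))"
    unfolding S_def Q using assms by (intro low_coeffs_lower_bound) (auto simp: A_def B_def)
  also have "\<dots> \<le> (\<Sum>j<\<tau>. norm (coeff (pcompose Q [:\<zeta>, 1:]) j))"
    using k by (intro sum_mono2) auto
  finally show False using small by (simp add: S_def)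
qed

text \<open>The radius of nearness is allowed to shrink as \<open>\<epsilon> = t ^ n\<close>. The
  threshold for the low coefficients then decays geometrically with ratio
  \<open>t ^ (Suc M * M)\<close>, and \<open>t < 1\<close> is taken so close to 1 that the given
  decay is faster.\<close>

lemma zero_rate_less_1I:
  fixes Q :: "nat \<Rightarrow> complex poly" and \<zeta> :: complex and M :: nat
  defines "c \<equiv> \<lambda>n j. coeff (pcompose (Q n) [:\<zeta>, 1:]) j"
  defines "S \<equiv> \<lambda>n. \<Sum>j\<le>M. norm (c n j)"
  assumes Q: "eventually (\<lambda>n. lead_coeff (Q n) = 1 \<and> degree (Q n) \<le> M) sequentially"
    and "\<tau> \<ge> 1" and small: "\<And>j. j < \<tau> \<Longrightarrow> exp_small (\<lambda>n. norm (c n j) / S n)"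
  shows "zero_rate Q \<zeta> \<tau> < 1"
proof -
  have "exp_small (\<lambda>n. \<Sum>j<\<tau>. norm (c n j) / S n)"
    using small by (intro exp_small_sum) auto
  then obtain \<theta> C where \<theta>: "0 < \<theta>" "\<theta> < 1" "C > 0"
    and le: "eventually (\<lambda>n. \<bar>\<Sum>j<\<tau>. norm (c n j) / S n\<bar> \<le> C * \<theta> ^ n) sequentially"
    by (rule exp_smallE)
  \<comment> \<open>With \<open>\<theta> = t ^ (2 * L)\<close>, one factor
    \<open>(t ^ L) ^ n\<close> eventually brings \<open>C\<close> below \<open>e\<close>, and the
    other lies below the decaying part of the threshold because \<open>L\<close> exceeds
    \<open>Suc M * M\<close>.\<close>
  define L where "L = Suc (Suc M * M)"
  define t where "t = root (2 * L) \<theta>"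
  have t: "0 < t" "t < 1" using \<theta> by (auto simp: t_def L_def)
  have tL: "t ^ (2 * L) = \<theta>" unfolding t_def using \<theta> by (intro real_root_pow_pos2) (auto simp: L_def)
  define e where "e = 1 / (2 * Suc M) ^ M / 2 ^ M"
  have e: "e > 0" by (simp add: e_def)
  have "(\<lambda>n. C * (t ^ L) ^ n) \<longlonglongrightarrow> C * 0"
    using t by (intro tendsto_mult tendsto_const LIMSEQ_power_zero) (simp add: power_less_one_iff L_def del: power_Suc)
  then have "eventually (\<lambda>n. C * (t ^ L) ^ n < e) sequentially"
    using e by (intro order_tendstoD(2)) auto
  then have "eventually (\<lambda>n. root n (zero_dist \<zeta> (Q n) \<tau>) \<le> t) sequentially"
    using le Q eventually_gt_at_top[of 0]
  proof eventually_elim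
    case (elim n)
    have "degree (pcompose (Q n) [:\<zeta>, 1:]) = degree (Q n)"
      by (simp add: degree_pcompose)
    moreover have "pcompose (Q n) [:\<zeta>, 1:] \<noteq> 0"
      using elim by (subst pcompose_eq_0_iff) auto
    ultimately have "c n (degree (Q n)) \<noteq> 0"
      unfolding c_def by (metis leading_coeff_0_iff)
    then have "0 < norm (c n (degree (Q n)))" by simp
    also have "\<dots> \<le> S n" unfolding S_def using elim by (intro member_le_sum) auto
    finally have S: "S n > 0" .
    have "C * \<theta> ^ n = C * (t ^ L) ^ n * (t ^ L) ^ n"
      unfolding tL[symmetric] by (simp add: power_mult[symmetric] power_add[symmetric] mult_ac flip: mult_2)
    also have "\<dots> < e * (t ^ L) ^ n"
      using elim t by (intro mult_strict_right_mono) auto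
    also have "\<dots> \<le> e * ((t ^ n) ^ Suc M) ^ M"
      unfolding power_mult[symmetric] using t e
      by (intro mult_left_mono power_decreasing) (auto simp: L_def algebra_simps)
    also have "\<dots> = ((t ^ n) ^ Suc M / (2 * Suc M)) ^ M / 2 ^ M"
      by (simp add: e_def power_divide)
    finally have "C * \<theta> ^ n < ((t ^ n) ^ Suc M / (2 * Suc M)) ^ M / 2 ^ M" .
    moreover have "(\<Sum>j<\<tau>. norm (c n j) / S n) \<le> C * \<theta> ^ n"
      using elim by linarith
    ultimately have "(\<Sum>j<\<tau>. norm (c n j)) / S n < ((t ^ n) ^ Suc M / (2 * Suc M)) ^ M / 2 ^ M"
      unfolding sum_divide_distrib by linarith
    then have "(\<Sum>j<\<tau>. norm (c n j)) < ((t ^ n) ^ Suc M / (2 * Suc M)) ^ M / 2 ^ M * S n"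
      using S by (simp only: pos_divide_less_eq)
    then have "\<tau> \<le> size (filter_mset (\<lambda>z. norm (\<zeta> - z) < t ^ n) (proots (Q n)))"
      using elim t unfolding c_def S_def
      by (intro near_zeros_of_small_coeffs[where M = M]) (auto intro: power_le_one)
    then have "zero_dist \<zeta> (Q n) \<tau> < t ^ n"
      using \<open>\<tau> \<ge> 1\<close> by (intro zero_dist_less)
    then have "root n (zero_dist \<zeta> (Q n) \<tau>) < root n (t ^ n)"
      using elim by (intro real_root_less_mono) auto
    also have "\<dots> = t" using elim t by (simp add: real_root_power_cancel)
    finally show ?case by simp
  qed
  then have "zero_rate Q \<zeta> \<tau> \<le> ereal t"
    unfolding zero_rate_def by (intro Limsup_bounded) simp
  also have "\<dots> < 1" using t by simp
  finally show ?thesis .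
qed

section \<open>Induction on the pole order and conclusion\<close>

theorem theorem2p1:
  fixes d :: nat and f :: "nat \<Rightarrow> complex fps" and m :: "nat \<Rightarrow> nat"
    and Q :: "nat \<Rightarrow> complex poly" and \<zeta> :: complex and \<tau> :: nat
  assumes "d \<ge> 1"
    and "\<exists>k\<in>{1..d}. m k \<noteq> 0"
    and "\<And>n. n \<ge> Max (m ` {1..d}) \<Longrightarrow> hermite_pade_denominator d f m n (Q n)"
    and "\<zeta> \<noteq> 0"
    and "is_system_pole d f m \<zeta> \<tau>"
  shows "pole_mu Q \<zeta> \<ge> \<tau>"
proof -
  \<comment> \<open>From \<open>n0\<close> on, the denominators are given and
    \<open>M \<le> n\<close> holds as well, as needed for the vanishing coefficient.\<close>
  define M n0 where "M = (\<Sum>k=1..d. m k)" and "n0 = max M (Max (m ` {1..d}))"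
  define adm where "adm = (\<lambda>p :: nat \<Rightarrow> complex poly. \<forall>k\<in>{1..d}. if m k = 0 then p k = 0 else degree (p k) < m k)"
  have n0: "m k \<le> n" if "n0 \<le> n" "k \<in> {1..d}" for n k
    using that Max_ge[of "m ` {1..d}" "m k"] by (simp add: n0_def)
  have den: "hermite_pade_denominator d f m n (Q n)" if "n \<ge> n0" for n
    using assms(3) that by (simp add: n0_def)
  have Q: "lead_coeff (Q n) = 1" "degree (Q n) \<le> M" if "n \<ge> n0" for n
    using hermite_pade_coeff_zero(1,2)[OF den n0] that by (simp_all add: M_def)
  have "\<exists>N\<le>n. n \<le> N + M \<and> (\<forall>p. adm p \<longrightarrow>
      fps_nth (fps_of_poly (Q n) * (\<Sum>k=1..d. fps_of_poly (p k) * f k)) N = 0)" if n: "n \<ge> n0" for n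
    unfolding M_def adm_def
    by (rule hermite_pade_coeff_zero(3)[OF den[OF n] n0[OF n]]) (use n in \<open>auto simp: n0_def M_def\<close>)
  then obtain N where N: "\<And>n. n \<ge> n0 \<Longrightarrow> N n \<le> n" "\<And>n. n \<ge> n0 \<Longrightarrow> n \<le> N n + M"
    "\<And>n p. n \<ge> n0 \<Longrightarrow> adm p \<Longrightarrow>
      fps_nth (fps_of_poly (Q n) * (\<Sum>k=1..d. fps_of_poly (p k) * f k)) (N n) = 0"
    by metis
  define c where "c = (\<lambda>n j. coeff (pcompose (Q n) [:\<zeta>, 1:]) j)"
  \<comment> \<open>A system pole of order \<open>\<tau>\<close> supplies a combination with a pole
    of order \<open>Suc s\<close> for each \<open>s < \<tau>\<close>. One index sequence
    \<open>N\<close> serves all these combinations, so strong induction on \<open>s\<close>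
    applies.\<close>
  have small: "s < \<tau> \<Longrightarrow> exp_small (\<lambda>n. norm (c n s) / (\<Sum>j\<le>M. norm (c n j)))" for s
  proof (induction s rule: less_induct)
    case (less s)
    have "Suc s \<in> {1..\<tau>}" using less.prems by simp
    then have "has_pole_combination d f m \<zeta> (Suc s)"
      using assms(5) unfolding is_system_pole_def by blast
    then obtain p where p: "adm p"
      "analytic_except_pole (\<Sum>k=1..d. fps_of_poly (p k) * f k) \<zeta> (Suc s)"
      unfolding has_pole_combination_def adm_def by blast
    show ?case unfolding c_def
    proof (rule taylor_coeff_exp_small_step[where N = N, OF assms(4) _ _ _ _ p(2)])
      fix j assume "j < s"
      then show "exp_small (\<lambda>n. cmod (coeff (Q n \<circ>\<^sub>p [:\<zeta>, 1:]) j) / (\<Sum>j\<le>M. cmod (coeff (Q n \<circ>\<^sub>p [:\<zeta>, 1:]) j)))"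
        using less by (simp add: c_def)
    qed (use Q N p(1) in \<open>auto intro!: eventually_sequentiallyI[of n0]\<close>)
  qed
  have "\<tau> \<ge> 1" using assms(5) by (simp add: is_system_pole_def)
  then have "zero_rate Q \<zeta> \<tau> < 1"
    using small Q unfolding c_def
    by (intro zero_rate_less_1I[where M = M]) (auto intro!: eventually_sequentiallyI[of n0])
  then show ?thesis
    by (rule pole_mu_geI[rotated]) (use Q in \<open>auto intro!: eventually_sequentiallyI[of n0]\<close>)
qed

end
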